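(* Let $P$ be a finite poset and let $M$ be a monoid (under function composition) consisting of regressive, order-preserving functions $P\to P$. If there are $f,g\in M$ and $x,y\in P$ such that $f(x)\not\leq g(x)$ and $f(y)\not\geq g(y)$, then $X(M)$ is not linear.
   Context: A function $f:P\to P$ on a poset is regressive if $f(p)\leq p$ for all $p\in P$, and order-preserving if $x\leq y$ implies $f(x)\leq f(y)$. The identity of $M$ is the identity function and the product is $(fg)(p)=f(g(p))$. For a monoid $M$ and $m\in M$, put $mM=\{mx : x\in M\}$. $X(M)=\{mM : m\in M\}$ is viewed as a poset ordered by inclusion; it is linear if any two of its elements are comparable under $\subseteq$. *)

theory Defs
  imports "HOL-Algebra.Coset"
begin

definition regressive :: "('a::order \<Rightarrow> 'a) \<Rightarrow> bool" where
  "regressive f \<longleftrightarrow> (\<forall>p. f p \<le> p)"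

definition function_monoid :: "('a \<Rightarrow> 'a) set \<Rightarrow> ('a \<Rightarrow> 'a) monoid" where
  "function_monoid M = \<lparr>carrier = M, monoid.mult = (\<circ>), one = id\<rparr>"

text \<open>The set \<open>X(M)\<close> of the sets \<open>m M\<close>; \<open>l_coset\<close> only uses the multiplication
  and makes sense in any monoid.\<close>

definition principal_right_ideals :: "('a, 'b) monoid_scheme \<Rightarrow> 'a set set" where
  "principal_right_ideals G = {m <#\<^bsub>G\<^esub> carrier G | m. m \<in> carrier G}"

end

theory Submission
  imports Defs
begin

text \<open>Inclusion of principal right ideals forces pointwise comparison, by
  \<open>le_if_principal_right_ideal_subset\<close>: if fM is contained in gM, then f = g o h for
  some h in M, and applying the monotone g to h p \<le> p gives f p \<le> g p. So if X(M) were
  linear, any two members of M would be pointwise comparable; the points x and y show that f and g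
  are not.\<close>

lemma le_if_principal_right_ideal_subset:
  fixes M :: "('a::order \<Rightarrow> 'a) set"
  assumes "monoid (function_monoid M)"
    and "\<And>h. h \<in> M \<Longrightarrow> regressive h"
    and "mono g"
    and "f \<in> M"
    and "f <#\<^bsub>function_monoid M\<^esub> M \<subseteq> g <#\<^bsub>function_monoid M\<^esub> M"
  shows "f \<le> g"
proof (rule le_funI)
  fix p
  have "id \<in> M"
    using monoid.one_closed[OF assms(1)] by (simp add: function_monoid_def)
  \<comment> \<open>The identity serves as the right factor: f = f o id. This turns the inclusion of
    ideals into a factorization of f through g.\<close>
  then have "f \<in> f <#\<^bsub>function_monoid M\<^esub> M"
    by (auto simp: l_coset_def function_monoid_def intro: bexI[of _ id])
  with assms(5) obtain h where "h \<in> M" and f: "f = g \<circ> h"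
    by (auto simp: l_coset_def function_monoid_def)
  then have "h p \<le> p"
    using assms(2) by (simp add: regressive_def)
  then show "f p \<le> g p"
    using assms(3) by (simp add: f monoD)
qed

theorem lemma3p2:
  fixes M :: "('a::{finite, order} \<Rightarrow> 'a) set"
    and f g :: "'a \<Rightarrow> 'a"
    and x y :: 'a
  assumes "monoid (function_monoid M)"
    and "\<And>h. h \<in> M \<Longrightarrow> regressive h"
    and "\<And>h. h \<in> M \<Longrightarrow> mono h"
    and "f \<in> M" and "g \<in> M"
    and "\<not> f x \<le> g x"
    and "\<not> f y \<ge> g y"
  shows "\<not> chain\<^sub>\<subseteq> (principal_right_ideals (function_monoid M))"
proof
  let ?I = "\<lambda>m. m <#\<^bsub>function_monoid M\<^esub> M"
  assume "chain\<^sub>\<subseteq> (principal_right_ideals (function_monoid M))"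
  moreover have "?I m \<in> principal_right_ideals (function_monoid M)" if "m \<in> M" for m
    using that by (auto simp: principal_right_ideals_def function_monoid_def)
  ultimately have "?I f \<subseteq> ?I g \<or> ?I g \<subseteq> ?I f"
    using assms(4,5) by (simp add: chain_subset_def)
  \<comment> \<open>The lemma is applied in both directions, with f and g exchanged in the second
    case.\<close>
  then have "f \<le> g \<or> g \<le> f"
    using le_if_principal_right_ideal_subset[OF assms(1,2)] assms(3-5) by blast
  \<comment> \<open>The point x rules out f \<le> g, and y rules out g \<le> f.\<close>
  then show False
    using assms(6,7) by (auto dest: le_funD)
qed

end
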